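(* Let $a>0$, let $z\in\mathbb{C}\setminus[-1,1]$ belong to the resolvent set of $H_a$, put $R_a(z)=(H_a-zI)^{-1}$, and let $n\ge1$. Then $$(R_a(z)e_n,e_m)=r_{n,m}(z)-4(a^2-1)D_a(z)^{-1}\,z\,\omega(z)^{n+m+2}\qquad\text{for } m\ge1,$$ and $$(R_a(z)e_n,e_0)=r_{n,0}(z)-2(a-1)D_a(z)^{-1}\,\omega(z)^{n+2}\,(2z+a\,\omega(z)).$$
   Context: $\mathbb{Z}_+=\{0,1,2,\dots\}$ and $(e_n)_{n\ge0}$ is the canonical orthonormal basis of $\ell^2(\mathbb{Z}_+)$. For $a>0$, $H_a$ is the bounded self-adjoint operator on $\ell^2(\mathbb{Z}_+)$ given by $$H_ae_0=\tfrac a2e_1,\qquad H_ae_1=\tfrac12(ae_0+e_2),\qquad H_ae_n=\tfrac12(e_{n-1}+e_{n+1})\ \ (n\ge2).$$ The branch of $\sqrt{z^2-1}$ is analytic on $\mathbb{C}\setminus[-1,1]$ and positive for $z>1$. Put $\omega(z)=z-\sqrt{z^2-1}$, $D_a(z)=1+(1-a^2)\omega(z)^2$, and for $n,m\in\mathbb{Z}_+$ $$r_{n,m}(z)=\frac{\omega(z)^{n+m+2}-\omega(z)^{|n-m|}}{\sqrt{z^2-1}}$$ (these are the matrix elements $((H_1-zI)^{-1}e_n,e_m)$ for $a=1$). *)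

theory Defs
  imports "HOL-Complex_Analysis.Complex_Analysis"
begin

typedef ell2 = "{x :: nat \<Rightarrow> complex. summable (\<lambda>n. (cmod (x n))\<^sup>2)}"
  morphisms coord Abs_ell2
  by (rule exI[of _ "\<lambda>_. 0"]) simp

setup_lifting type_definition_ell2

lemma square_summable_add:
  assumes "summable (\<lambda>n. (cmod (x n))\<^sup>2)" "summable (\<lambda>n. (cmod (y n))\<^sup>2)"
  shows "summable (\<lambda>n. (cmod (x n + y n))\<^sup>2)"
proof (rule summable_comparison_test')
  show "summable (\<lambda>n. 2 * (cmod (x n))\<^sup>2 + 2 * (cmod (y n))\<^sup>2)"
    using assms by (intro summable_add summable_mult)
  fix n
  have "(cmod (x n + y n))\<^sup>2 \<le> (cmod (x n) + cmod (y n))\<^sup>2"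
    by (intro power_mono norm_triangle_ineq) auto
  also have "\<dots> \<le> 2 * (cmod (x n))\<^sup>2 + 2 * (cmod (y n))\<^sup>2"
    using sum_squares_bound[of "cmod (x n)" "cmod (y n)"] by (simp add: power2_sum)
  finally show "norm ((cmod (x n + y n))\<^sup>2) \<le> 2 * (cmod (x n))\<^sup>2 + 2 * (cmod (y n))\<^sup>2"
    by simp
qed

lemma square_summable_scale:
  assumes "summable (\<lambda>n. (cmod (x n))\<^sup>2)"
  shows "summable (\<lambda>n. (cmod (c * x n))\<^sup>2)"
  using summable_mult[OF assms, of "(cmod c)\<^sup>2"]
  by (simp add: norm_mult power_mult_distrib)

lift_definition scaleC :: "complex \<Rightarrow> ell2 \<Rightarrow> ell2" (infixr \<open>*\<^sub>C\<close> 75)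
  is "\<lambda>c x n. c * x n"
  by (rule square_summable_scale)

text \<open>Linear in the first argument, antilinear in the second.\<close>

definition cinner :: "ell2 \<Rightarrow> ell2 \<Rightarrow> complex" where
  "cinner x y = (\<Sum>n. coord x n * cnj (coord y n))"

lemma summable_coord: "summable (\<lambda>n. (cmod (coord x n))\<^sup>2)"
  using coord[of x] by simp

lemma summable_cinner: "summable (\<lambda>n. coord x n * cnj (coord y n))"
proof (rule summable_comparison_test')
  show "summable (\<lambda>n. (cmod (coord x n))\<^sup>2 + (cmod (coord y n))\<^sup>2)"
    by (intro summable_add summable_coord)
  fix n
  have "2 * cmod (coord x n) * cmod (coord y n) \<le> (cmod (coord x n))\<^sup>2 + (cmod (coord y n))\<^sup>2"
    by (rule sum_squares_bound)
  moreover have "0 \<le> cmod (coord x n) * cmod (coord y n)" by simp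
  ultimately show "norm (coord x n * cnj (coord y n))
      \<le> (cmod (coord x n))\<^sup>2 + (cmod (coord y n))\<^sup>2"
    unfolding norm_mult complex_mod_cnj by linarith
qed

instantiation ell2 :: real_vector
begin

lift_definition zero_ell2 :: ell2 is "\<lambda>_. 0" by simp
lift_definition plus_ell2 :: "ell2 \<Rightarrow> ell2 \<Rightarrow> ell2" is "\<lambda>x y n. x n + y n"
  by (rule square_summable_add)
lift_definition uminus_ell2 :: "ell2 \<Rightarrow> ell2" is "\<lambda>x n. - x n" by simp
definition minus_ell2 :: "ell2 \<Rightarrow> ell2 \<Rightarrow> ell2" where "minus_ell2 x y = x + (- y)"
definition scaleR_ell2 :: "real \<Rightarrow> ell2 \<Rightarrow> ell2" where "scaleR_ell2 t x = complex_of_real t *\<^sub>C x"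

lemma coord_eqI: "(\<And>n. coord x n = coord y n) \<Longrightarrow> x = y"
  by (metis coord_inject ext)

lemma coord_simps [simp]:
  "coord 0 n = 0" "coord (x + y) n = coord x n + coord y n" "coord (- x) n = - coord x n"
  "coord (x - y) n = coord x n - coord y n" "coord (c *\<^sub>C x) n = c * coord x n"
  "coord (t *\<^sub>R x) n = complex_of_real t * coord x n"
  by (simp_all add: zero_ell2.rep_eq plus_ell2.rep_eq uminus_ell2.rep_eq minus_ell2_def
      scaleC.rep_eq scaleR_ell2_def)

instance
  by standard (auto intro!: coord_eqI simp: algebra_simps)

end

text \<open>The Hilbert norm enters through the real inner product \<open>Re (x, y)\<close>.\<close>

instantiation ell2 :: real_inner
begin

definition inner_ell2 :: "ell2 \<Rightarrow> ell2 \<Rightarrow> real" where "inner_ell2 x y = Re (cinner x y)"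
definition norm_ell2 :: "ell2 \<Rightarrow> real" where "norm_ell2 x = sqrt (inner x x)"
definition sgn_ell2 :: "ell2 \<Rightarrow> ell2" where "sgn_ell2 x = x /\<^sub>R norm x"
definition dist_ell2 :: "ell2 \<Rightarrow> ell2 \<Rightarrow> real" where "dist_ell2 x y = norm (x - y)"
definition uniformity_ell2 :: "(ell2 \<times> ell2) filter" where
  "uniformity_ell2 = (INF e\<in>{0 <..}. principal {(x, y). dist x y < e})"
definition open_ell2 :: "ell2 set \<Rightarrow> bool" where
  "open_ell2 U = (\<forall>x\<in>U. eventually (\<lambda>(x', y). x' = x \<longrightarrow> y \<in> U) uniformity)"

lemma cinner_self: "cinner x x = complex_of_real (\<Sum>n. (cmod (coord x n))\<^sup>2)"
  unfolding cinner_def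
  by (simp add: complex_norm_square [symmetric] suminf_of_real [OF summable_coord] del: of_real_power)

lemma cinner_cnj: "cinner y x = cnj (cinner x y)"
proof -
  have "(\<lambda>n. cnj (coord x n * cnj (coord y n))) sums cnj (cinner x y)"
    unfolding cinner_def sums_cnj by (rule summable_sums [OF summable_cinner])
  then show ?thesis
    by (simp add: cinner_def sums_iff mult.commute)
qed

lemma cinner_add_left: "cinner (x + y) w = cinner x w + cinner y w"
  unfolding cinner_def
  by (simp add: ring_distribs suminf_add [OF summable_cinner summable_cinner])

lemma cinner_scaleC_left: "cinner (c *\<^sub>C x) y = c * cinner x y"
  unfolding cinner_def
  by (simp add: mult.assoc suminf_mult [OF summable_cinner])

instance
proof
  fix x y w :: ell2 and s t :: real
  show "sgn x = x /\<^sub>R norm x" "dist x y = norm (x - y)" "norm x = sqrt (inner x x)"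
    "(uniformity :: (ell2 \<times> ell2) filter) = (INF e\<in>{0 <..}. principal {(x, y). dist x y < e})"
    by (simp_all add: sgn_ell2_def dist_ell2_def uniformity_ell2_def norm_ell2_def)
  show "open U = (\<forall>x\<in>U. eventually (\<lambda>(x', y). x' = x \<longrightarrow> y \<in> U) uniformity)" for U :: "ell2 set"
    by (rule open_ell2_def)
  show "inner x y = inner y x"
    by (subst (2) inner_ell2_def, subst cinner_cnj) (simp add: inner_ell2_def)
  show "inner (x + y) w = inner x w + inner y w" "inner (s *\<^sub>R x) y = s * inner x y"
    by (simp_all add: inner_ell2_def scaleR_ell2_def cinner_add_left cinner_scaleC_left)
  show "0 \<le> inner x x"
    by (simp add: inner_ell2_def cinner_self suminf_nonneg summable_coord)
  show "inner x x = 0 \<longleftrightarrow> x = 0"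
    by (auto intro!: coord_eqI simp: inner_ell2_def cinner_self suminf_eq_zero_iff summable_coord)
qed

end

lemma norm_ell2_eq: "norm x = sqrt (\<Sum>n. (cmod (coord x n))\<^sup>2)"
  by (simp add: norm_ell2_def inner_ell2_def cinner_self)

lift_definition e_vec :: "nat \<Rightarrow> ell2" is "\<lambda>n k. if k = n then 1 else 0"
  by (rule summable_finite [of "{n}" for n]) (auto split: if_splits)

lemma coord_e [simp]: "coord (e_vec n) k = (if k = n then 1 else 0)"
  by (simp add: e_vec.rep_eq)

lemma cinner_e: "cinner x (e_vec m) = coord x m"
proof -
  have "(\<Sum>n. coord x n * cnj (coord (e_vec m) n)) = (\<Sum>n\<in>{m}. coord x n * cnj (coord (e_vec m) n))"
    by (rule suminf_finite) auto
  then show ?thesis by (simp add: cinner_def)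
qed

definition bounded_clinear :: "(ell2 \<Rightarrow> ell2) \<Rightarrow> bool" where
  "bounded_clinear T \<longleftrightarrow> bounded_linear T \<and> (\<forall>c x. T (c *\<^sub>C x) = c *\<^sub>C T x)"

definition self_adjoint :: "(ell2 \<Rightarrow> ell2) \<Rightarrow> bool" where
  "self_adjoint T \<longleftrightarrow> (\<forall>x y. cinner (T x) y = cinner x (T y))"

definition resolvent :: "(ell2 \<Rightarrow> ell2) \<Rightarrow> complex \<Rightarrow> ell2 \<Rightarrow> ell2" where
  "resolvent T z = inv (\<lambda>x. T x - z *\<^sub>C x)"

definition resolvent_set :: "(ell2 \<Rightarrow> ell2) \<Rightarrow> complex set" where
  "resolvent_set T = {z. bij (\<lambda>x. T x - z *\<^sub>C x) \<and> bounded_clinear (resolvent T z)}"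

definition jacobi_on_basis :: "real \<Rightarrow> (ell2 \<Rightarrow> ell2) \<Rightarrow> bool" where
  "jacobi_on_basis a T \<longleftrightarrow>
     T (e_vec 0) = (a / 2) *\<^sub>R e_vec 1 \<and>
     T (e_vec 1) = (1 / 2) *\<^sub>R (a *\<^sub>R e_vec 0 + e_vec 2) \<and>
     (\<forall>n\<ge>2. T (e_vec n) = (1 / 2) *\<^sub>R (e_vec (n - 1) + e_vec (n + 1)))"

definition H_op :: "real \<Rightarrow> ell2 \<Rightarrow> ell2" where
  "H_op a = (THE T. bounded_clinear T \<and> self_adjoint T \<and> jacobi_on_basis a T)"

text \<open>The description defining \<open>H_op a\<close> is satisfied by exactly one operator, for every real \<open>a\<close>.\<close>

lift_definition left_shift :: "ell2 \<Rightarrow> ell2" is "\<lambda>x n. x (Suc n)"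
  by (subst summable_Suc_iff)

lift_definition right_shift :: "ell2 \<Rightarrow> ell2" is "\<lambda>x n. case n of 0 \<Rightarrow> 0 | Suc k \<Rightarrow> x k"
  by (subst summable_Suc_iff [symmetric]) simp

lemma coord_shift [simp]:
  "coord (left_shift x) n = coord x (Suc n)"
  "coord (right_shift x) n = (case n of 0 \<Rightarrow> 0 | Suc k \<Rightarrow> coord x k)"
  by (simp_all add: left_shift.rep_eq right_shift.rep_eq)

lemma norm_right_shift: "norm (right_shift x) = norm x"
  using suminf_split_head [OF summable_coord [of "right_shift x"]]
  by (simp add: norm_ell2_eq)

lemma norm_left_shift: "norm (left_shift x) \<le> norm x"
  using suminf_split_head [OF summable_coord [of x]]
  by (simp add: norm_ell2_eq)

lemma cinner_shift: "cinner (left_shift x) y = cinner x (right_shift y)"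
  using suminf_split_head [OF summable_cinner [of x "right_shift y"]]
  by (simp add: cinner_def)

lemma cinner_add_right: "cinner x (y + w) = cinner x y + cinner x w"
  by (metis cinner_add_left cinner_cnj complex_cnj_add)

lemma cinner_scaleC_right: "cinner x (c *\<^sub>C y) = cnj c * cinner x y"
  by (metis cinner_scaleC_left cinner_cnj complex_cnj_mult)

lemma jacobi_ex1: "\<exists>!T. bounded_clinear T \<and> self_adjoint T \<and> jacobi_on_basis a T"
proof (rule ex_ex1I)
  define P :: "ell2 \<Rightarrow> ell2" where "P x = coord x 1 *\<^sub>C e_vec 0 + coord x 0 *\<^sub>C e_vec 1" for x
  define T where "T x = (1/2) *\<^sub>R (left_shift x + right_shift x) + ((a - 1)/2) *\<^sub>R P x" for x
  have shifts: "bounded_linear left_shift" "bounded_linear right_shift"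
    by (rule bounded_linear_intro [where K = 1];
        auto intro!: coord_eqI simp: norm_left_shift norm_right_shift split: nat.splits)+
  have coord_bound: "cmod (coord x n) \<le> norm x" for x n
  proof -
    have "(cmod (coord x n))\<^sup>2 = (\<Sum>k\<in>{n}. (cmod (coord x k))\<^sup>2)" by simp
    also have "\<dots> \<le> (\<Sum>k. (cmod (coord x k))\<^sup>2)"
      by (rule sum_le_suminf [OF summable_coord]) auto
    finally show ?thesis
      unfolding norm_ell2_eq by (rule real_le_rsqrt)
  qed
  have norm_scaleC: "norm (c *\<^sub>C x) = cmod c * norm x" for c x
    unfolding norm_ell2_eq
    by (simp add: norm_mult power_mult_distrib suminf_mult [OF summable_coord] real_sqrt_mult)
  have coord_term: "bounded_linear (\<lambda>x. coord x n *\<^sub>C e_vec m)" for n m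
    by (rule bounded_linear_intro [where K = "norm (e_vec m)"])
      (auto intro!: coord_eqI mult_right_mono coord_bound simp: norm_scaleC distrib_right)
  have "bounded_linear T"
    unfolding T_def P_def
    by (intro bounded_linear_add shifts coord_term bounded_linear_compose [OF bounded_linear_scaleR_right])
  moreover have "T (c *\<^sub>C x) = c *\<^sub>C T x" for c x
    by (auto intro!: coord_eqI simp: T_def P_def algebra_simps split: nat.splits)
  ultimately have 1: "bounded_clinear T" by (simp add: bounded_clinear_def)
  have swap: "cinner (right_shift x) y = cinner x (left_shift y)" for x y
    by (metis cinner_shift cinner_cnj)
  have e_left: "cinner (e_vec m) x = cnj (coord x m)" for m x
    by (metis cinner_cnj cinner_e)
  have 2: "self_adjoint T"
    unfolding self_adjoint_def T_def P_def scaleR_ell2_def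
    by (simp add: cinner_add_left cinner_add_right cinner_scaleC_left cinner_scaleC_right
        cinner_shift swap cinner_e e_left algebra_simps)
  have 3: "jacobi_on_basis a T"
    unfolding jacobi_on_basis_def T_def P_def
    by (auto intro!: coord_eqI simp: field_simps split: nat.splits)
  show "\<exists>T. bounded_clinear T \<and> self_adjoint T \<and> jacobi_on_basis a T"
    using 1 2 3 by blast
next
  fix S T
  assume S: "bounded_clinear S \<and> self_adjoint S \<and> jacobi_on_basis a S"
    and T: "bounded_clinear T \<and> self_adjoint T \<and> jacobi_on_basis a T"
  have eq: "S (e_vec n) = T (e_vec n)" for n
  proof -
    consider "n = 0" | "n = 1" | "n \<ge> 2" by linarith
    then show ?thesis using S T by cases (auto simp: jacobi_on_basis_def)
  qed
  show "S = T"
  proof (rule ext, rule coord_eqI)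
    fix x n
    show "coord (S x) n = coord (T x) n"
      using S T eq [of n] by (metis cinner_e self_adjoint_def)
  qed
qed

lemma H_props: "bounded_clinear (H_op a)" "self_adjoint (H_op a)" "jacobi_on_basis a (H_op a)"
  using theI' [OF jacobi_ex1 [of a]] by (simp_all add: H_op_def)

abbreviation slit :: "complex set" where
  "slit \<equiv> complex_of_real ` {-1..1}"

definition sqrt_branch :: "complex \<Rightarrow> complex" where
  "sqrt_branch z = csqrt (z - 1) * csqrt (z + 1)"

text \<open>On the complement of \<open>[-1, 1]\<close> this is the analytic square root of \<open>z\<^sup>2 - 1\<close> that is
  positive for \<open>z > 1\<close>, and these properties determine it.\<close>

lemma sqrt_branch_square: "(sqrt_branch z)\<^sup>2 = z\<^sup>2 - 1"
  by (simp add: sqrt_branch_def power_mult_distrib) (simp add: algebra_simps power2_eq_square)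

lemma sqrt_branch_pos:
  assumes "x > 1"
  shows "sqrt_branch (complex_of_real x) = complex_of_real (sqrt (x\<^sup>2 - 1))"
proof -
  have "sqrt_branch (complex_of_real x) = csqrt (of_real (x - 1)) * csqrt (of_real (x + 1))"
    by (simp add: sqrt_branch_def)
  also have "\<dots> = of_real (sqrt (x - 1) * sqrt (x + 1))"
    using assms csqrt_of_real_nonneg [of "x - 1"] csqrt_of_real_nonneg [of "x + 1"]
    by (simp only: Re_complex_of_real Im_complex_of_real of_real_mult)
  also have "sqrt (x - 1) * sqrt (x + 1) = sqrt (x\<^sup>2 - 1)"
    by (simp add: real_sqrt_mult [symmetric] algebra_simps power2_eq_square)
  finally show ?thesis .
qed

lemma slit_iff: "z \<in> slit \<longleftrightarrow> Im z = 0 \<and> \<bar>Re z\<bar> \<le> 1"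
  by (auto simp: image_iff complex_eq_iff intro!: bexI [of _ "Re z"])

lemma sqrt_branch_holomorphic: "sqrt_branch holomorphic_on - slit"
proof -
  define A where "A = {z. Im z < 0} \<union> {z. Im z > 0} \<union> {z. Re z > 1}"
  define B where "B = {z. Im z < 0} \<union> {z. Im z > 0} \<union> {z. Re z < -1}"
  have "open A" "open B"
    unfolding A_def B_def
    by (intro open_Un open_halfspace_Im_lt open_halfspace_Im_gt open_halfspace_Re_lt
        open_halfspace_Re_gt)+
  have "sqrt_branch holomorphic_on A"
    unfolding sqrt_branch_def
    by (intro holomorphic_intros) (auto simp: A_def complex_nonpos_Reals_iff)
  moreover have "sqrt_branch holomorphic_on B"
  proof (rule holomorphic_transform)
    show "(\<lambda>z. - (csqrt (1 - z) * csqrt (- z - 1))) holomorphic_on B"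
      by (intro holomorphic_intros) (auto simp: B_def complex_nonpos_Reals_iff)
    fix z assume "z \<in> B"
    then consider "Im z < 0" | "Im z > 0 \<or> (Im z = 0 \<and> Re z < -1)"
      by (cases "Im z" "0::real" rule: linorder_cases) (auto simp: B_def)
    then show "- (csqrt (1 - z) * csqrt (- z - 1)) = sqrt_branch z"
    proof cases
      case 1
      then have "csqrt (- (z - 1)) = \<i> * csqrt (z - 1)" "csqrt (- (z + 1)) = \<i> * csqrt (z + 1)"
        by (intro csqrt_minus; simp)+
      moreover have "- (z - 1) = 1 - z" "- (z + 1) = - z - 1" by simp_all
      ultimately show ?thesis by (simp add: sqrt_branch_def mult.assoc mult.left_commute)
    next
      case 2
      then have "csqrt (- (1 - z)) = \<i> * csqrt (1 - z)" "csqrt (- (- z - 1)) = \<i> * csqrt (- z - 1)"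
        by (intro csqrt_minus; auto)+
      moreover have "- (1 - z) = z - 1" "- (- z - 1) = z + 1" by simp_all
      ultimately show ?thesis by (simp add: sqrt_branch_def add.commute mult.assoc mult.left_commute)
    qed
  qed
  ultimately have "sqrt_branch holomorphic_on A \<union> B"
    using \<open>open A\<close> \<open>open B\<close> by (rule holomorphic_on_Un)
  then show ?thesis
    by (rule holomorphic_on_subset) (auto simp: A_def B_def slit_iff)
qed

lemma sqrt_branch_unique:
  assumes "f holomorphic_on - slit"
    and "\<And>z. z \<notin> slit \<Longrightarrow> (f z)\<^sup>2 = z\<^sup>2 - 1"
    and "\<And>x. x > 1 \<Longrightarrow> f (complex_of_real x) \<in> \<real> \<and> Re (f (complex_of_real x)) > 0"
    and "z \<notin> slit"
  shows "f z = sqrt_branch z"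
proof -
  have nz: "sqrt_branch w \<noteq> 0" if "w \<notin> slit" for w
  proof
    assume "sqrt_branch w = 0"
    then have "w = 1 \<or> w = -1"
      using sqrt_branch_square [of w] by (simp add: power2_eq_1_iff)
    with that show False by (auto simp: slit_iff)
  qed
  define q where "q w = f w / sqrt_branch w" for w
  have slit_eq: "slit = closed_segment (-1) 1"
    using closed_segment_of_real [of "-1" 1, where 'a = complex]
    by (simp add: closed_segment_eq_real_ivl)
  have conn: "connected (- slit)"
    by (rule connected_complement_bounded_convex) (auto simp: slit_eq bounded_closed_segment)
  have cont: "continuous_on (- slit) q"
    unfolding q_def using nz assms(1) sqrt_branch_holomorphic
    by (intro continuous_intros holomorphic_on_imp_continuous_on) auto
  have "(q w)\<^sup>2 = 1" if "w \<in> - slit" for w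
  proof -
    have "(f w)\<^sup>2 = (sqrt_branch w)\<^sup>2"
      using that assms(2) [of w] sqrt_branch_square [of w]
      by (metis ComplD)
    moreover have "sqrt_branch w \<noteq> 0"
      by (rule nz) (use that in blast)
    ultimately show ?thesis
      by (simp add: q_def power_divide)
  qed
  then have "q ` (- slit) \<subseteq> {1, -1}"
    by (auto simp: power2_eq_1_iff)
  then have "q constant_on - slit"
    using continuous_finite_range_constant [OF conn cont] finite_subset by blast
  then obtain c where c: "\<And>w. w \<notin> slit \<Longrightarrow> q w = c"
    by (auto simp: constant_on_def)
  have two: "(2::complex) \<notin> slit" by (auto simp: slit_iff)
  have pos2: "sqrt_branch 2 = of_real (sqrt 3)"
    using sqrt_branch_pos [of 2] by simp
  have "f 2 \<in> \<real> \<and> Re (f 2) > 0"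
    using assms(3) [of 2] by simp
  moreover have "c = 1 \<or> c = -1"
    using \<open>q ` (- slit) \<subseteq> {1, -1}\<close> c [OF two] two by auto
  moreover have "f 2 = c * of_real (sqrt 3)"
    using c [OF two] nz [OF two] pos2 by (auto simp: q_def field_simps)
  ultimately have "c = 1" by auto
  then show ?thesis
    using c [OF assms(4)] nz [OF assms(4)] by (simp add: q_def)
qed

definition omega :: "complex \<Rightarrow> complex" where
  "omega z = z - sqrt_branch z"

definition D_fun :: "real \<Rightarrow> complex \<Rightarrow> complex" where
  "D_fun a z = 1 + (1 - (complex_of_real a)\<^sup>2) * (omega z)\<^sup>2"

definition r_kern :: "nat \<Rightarrow> nat \<Rightarrow> complex \<Rightarrow> complex" where
  "r_kern n m z = (omega z ^ (n + m + 2) - omega z ^ nat \<bar>int n - int m\<bar>) / sqrt_branch z"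

end

theory Submission
  imports Defs
begin

text \<open>Since \<open>|\<omega>(z)| < 1\<close> off the slit and \<open>2z\<omega> = 1 + \<omega>\<^sup>2\<close>, the claimed entries form a
  square-summable solution of the three-term recurrence encoding \<open>(H\<^sub>a - z) u = e\<^sub>n\<close>; bijectivity of
  \<open>H\<^sub>a - z\<close> makes it the only one. Moreover \<open>D\<^sub>a(z) \<noteq> 0\<close>, because otherwise the vector with entries
  \<open>1/a, \<omega>, \<omega>\<^sup>2, \<dots>\<close> would be an eigenvector of \<open>H\<^sub>a\<close> for \<open>z\<close>.\<close>

section \<open>Algebra and size of \<open>omega\<close> off the slit\<close>

lemma sqrt_branch_nonzero:
  assumes "z \<notin> slit"
  shows "sqrt_branch z \<noteq> 0"
proof
  assume "sqrt_branch z = 0"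
  then have "z = 1 \<or> z = -1"
    using sqrt_branch_square [of z] by (simp add: power2_eq_1_iff)
  with assms show False by (auto simp: slit_iff)
qed

lemma omega_mult_conj: "omega z * (z + sqrt_branch z) = 1"
  using sqrt_branch_square [of z] by (simp add: omega_def algebra_simps power2_eq_square)

lemma omega_nonzero: "omega z \<noteq> 0"
  using omega_mult_conj [of z] by auto

text \<open>So \<open>omega z\<close> is a root of \<open>t^2 - 2 * z * t + 1\<close>, the
  characteristic polynomial of the free three-term recurrence, which its powers therefore
  solve.\<close>

lemma two_z_omega: "2 * z * omega z = 1 + (omega z)\<^sup>2"
proof -
  have "sqrt_branch z = z - omega z" by (simp add: omega_def)
  with omega_mult_conj [of z] show ?thesis by (simp add: algebra_simps power2_eq_square)
qed

lemma omega_power_rec: "omega z ^ k + omega z ^ Suc (Suc k) = 2 * z * omega z ^ Suc k"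
  using arg_cong [OF two_z_omega [of z], of "\<lambda>t. omega z ^ k * t"]
  by (simp add: algebra_simps power2_eq_square)

lemma two_sqrt_branch_omega: "2 * sqrt_branch z * omega z = 1 - (omega z)\<^sup>2"
proof -
  have "z = omega z + sqrt_branch z" by (simp add: omega_def)
  with two_z_omega [of z] show ?thesis by algebra
qed

text \<open>This strict sign makes the sum of the two roots longer than their difference. Off the
  real axis both roots lie in the same open quadrant; on it, beyond the slit, they are both real or
  both imaginary.\<close>

lemma csqrt_shift_inner_pos:
  assumes "z \<notin> slit"
  shows "inner (csqrt (z - 1)) (csqrt (z + 1)) > 0"
proof (cases "Im z = 0")
  case False
  have "Re (csqrt w) > 0" if "Im w \<noteq> 0" for w
  proof -
    have "Im w = 2 * Re (csqrt w) * Im (csqrt w)"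
      by (metis Im_power2 power2_csqrt)
    with that have "Re (csqrt w) \<noteq> 0" by (metis mult_eq_0_iff)
    with csqrt_principal [of w] show ?thesis by blast
  qed
  then have "Re (csqrt (z - 1)) * Re (csqrt (z + 1)) > 0"
    using False by (intro mult_pos_pos) (simp_all del: csqrt.simps)
  \<comment> \<open>Both imaginary parts carry the sign of \<open>Im z\<close>, which the real
    shifts leave unchanged.\<close>
  moreover have "Im (csqrt (z - 1)) * Im (csqrt (z + 1)) \<ge> 0"
    using False complex_Re_le_cmod [of "z - 1"] complex_Re_le_cmod [of "z + 1"]
    by (auto simp: sgn_if)
  ultimately show ?thesis by (simp add: inner_complex_def)
next
  case True
  then obtain x where x: "z = of_real x"
    by (metis complex_is_Real_iff Reals_cases)
  with assms have "x > 1 \<or> x < -1" by (auto simp: slit_iff)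
  then show ?thesis
  proof
    assume "x > 1"
    then have "csqrt (z - 1) = of_real (sqrt (x - 1))" "csqrt (z + 1) = of_real (sqrt (x + 1))"
      using csqrt_of_real_nonneg [of "x - 1"] csqrt_of_real_nonneg [of "x + 1"] by (simp_all add: x)
    with \<open>x > 1\<close> show ?thesis by (simp add: inner_complex_def)
  next
    assume "x < -1"
    then have "csqrt (z - 1) = \<i> * of_real (sqrt (1 - x))" "csqrt (z + 1) = \<i> * of_real (sqrt (- 1 - x))"
      using csqrt_of_real_nonpos [of "x - 1"] csqrt_of_real_nonpos [of "x + 1"] by (simp_all add: x)
    with \<open>x < -1\<close> show ?thesis by (simp add: inner_complex_def)
  qed
qed

text \<open>With \<open>p, q\<close> the roots of \<open>z - 1, z + 1\<close> one has \<open>z \<mp> sqrt_branch z = (p \<mp> q)\<^sup>2 / 2\<close>, and these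
  two numbers have product 1.\<close>

lemma norm_omega_less_1:
  assumes "z \<notin> slit"
  shows "cmod (omega z) < 1"
proof -
  define p q where "p = csqrt (z - 1)" and "q = csqrt (z + 1)"
  have sq: "p\<^sup>2 = z - 1" "q\<^sup>2 = z + 1" by (simp_all add: p_def q_def)
  have omega: "omega z = (p - q)\<^sup>2 / 2" and conj: "z + sqrt_branch z = (p + q)\<^sup>2 / 2"
    by (simp_all add: power2_diff power2_sum sq omega_def sqrt_branch_def flip: p_def q_def)
  have "(cmod (p - q))\<^sup>2 < (cmod (p + q))\<^sup>2"
    using csqrt_shift_inner_pos [OF assms] by (simp add: power2_norm_eq_inner inner_simps inner_commute p_def q_def)
  then have less: "cmod (omega z) < cmod (z + sqrt_branch z)"
    by (simp add: omega conj norm_divide norm_power)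
  have "cmod (omega z) * cmod (z + sqrt_branch z) = 1"
    using omega_mult_conj [of z] by (metis norm_mult norm_one)
  then show ?thesis
    using less by (smt (verit) mult_le_cancel_right1 norm_ge_zero mult_less_cancel_right1)
qed

section \<open>Square-summable sequences and the operator in coordinates\<close>

text \<open>\<open>Abs_ell2\<close> can be undone only on square-summable sequences. The offset
  \<open>N\<close> allows arbitrary initial entries before the geometric tail.\<close>

lemma coord_Abs_geometric_tail:
  assumes "cmod w < 1" "\<And>k. x (k + N) = c * w ^ k"
  shows "coord (Abs_ell2 x) = x"
proof -
  have "summable (\<lambda>k. (cmod c)\<^sup>2 * ((cmod w)\<^sup>2) ^ k)"
    using assms(1) by (intro summable_mult summable_geometric) (simp add: abs_square_less_1)
  then have "summable (\<lambda>k. (cmod (x (k + N)))\<^sup>2)"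
    by (simp add: assms(2) norm_mult norm_power power_mult_distrib power_mult [symmetric] mult.commute)
  then have "summable (\<lambda>k. (cmod (x k))\<^sup>2)"
    by (subst (asm) summable_iff_shift)
  then show ?thesis by (simp add: Abs_ell2_inverse)
qed

text \<open>Self-adjointness moves the operator onto \<open>e_vec m\<close>, where its action is
  prescribed.\<close>

lemma coord_H_op:
  "coord (H_op a x) 0 = complex_of_real a / 2 * coord x 1"
  "coord (H_op a x) 1 = (complex_of_real a * coord x 0 + coord x 2) / 2"
  "coord (H_op a x) (Suc (Suc k)) = (coord x (Suc k) + coord x (Suc (Suc (Suc k)))) / 2"
proof -
  have "coord (H_op a x) m = cinner x (H_op a (e_vec m))" for m
    using H_props(2) [of a] by (metis cinner_e self_adjoint_def)
  then show
    "coord (H_op a x) 0 = complex_of_real a / 2 * coord x 1"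
    "coord (H_op a x) 1 = (complex_of_real a * coord x 0 + coord x 2) / 2"
    "coord (H_op a x) (Suc (Suc k)) = (coord x (Suc k) + coord x (Suc (Suc (Suc k)))) / 2"
    using H_props(3) [of a]
    by (simp_all add: jacobi_on_basis_def scaleR_ell2_def cinner_add_right cinner_scaleC_right cinner_e)
qed

lemma H_op_minus_eqI:
  assumes "complex_of_real a / 2 * coord x 1 - z * coord x 0 = coord y 0"
    and "(complex_of_real a * coord x 0 + coord x 2) / 2 - z * coord x 1 = coord y 1"
    and "\<And>k. (coord x (Suc k) + coord x (Suc (Suc (Suc k)))) / 2 - z * coord x (Suc (Suc k))
          = coord y (Suc (Suc k))"
  shows "H_op a x - z *\<^sub>C x = y"
proof (rule coord_eqI)
  fix k
  consider "k = 0" | "k = 1" | l where "k = Suc (Suc l)"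
    by (metis One_nat_def not0_implies_Suc)
  then show "coord (H_op a x - z *\<^sub>C x) k = coord y k"
    using assms by cases (simp_all only: coord_simps coord_H_op)
qed

lemma D_fun_nonzero:
  assumes "a > 0" "z \<notin> slit" "z \<in> resolvent_set (H_op a)"
  shows "D_fun a z \<noteq> 0"
proof
  assume D: "D_fun a z = 0"
  define w where "w = omega z"
  \<comment> \<open>The entry \<open>1 / a\<close> is forced by row 1:
    \<open>a * v 0 = 2 * z * w - w^2 = 1\<close>.\<close>
  define v where "v k = (if k = 0 then 1 / complex_of_real a else w ^ k)" for k
  have w: "2 * z * w = 1 + w\<^sup>2" "cmod w < 1" "w \<noteq> 0"
    using two_z_omega norm_omega_less_1 [OF assms(2)] omega_nonzero by (simp_all add: w_def)
  have aw: "(of_real a)\<^sup>2 * w\<^sup>2 = 1 + w\<^sup>2"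
    using D by (simp add: D_fun_def w_def algebra_simps)
  have v: "coord (Abs_ell2 v) = v"
    by (rule coord_Abs_geometric_tail [where w = w and N = 1 and c = w]) (simp_all add: v_def w)
  have "(of_real a)\<^sup>2 * w * w = 2 * z * w"
    using aw w(1) by (simp add: power2_eq_square mult.assoc)
  \<comment> \<open>After division by \<open>w\<close>, vanishing of \<open>D_fun a z\<close>
    becomes exactly the row 0 condition for \<open>v\<close>.\<close>
  then have aw': "(of_real a)\<^sup>2 * w = 2 * z"
    using w(3) by simp
  have rec: "w ^ k + w ^ Suc (Suc k) = 2 * z * w ^ Suc k" for k
    unfolding w_def by (rule omega_power_rec)
  have "H_op a (Abs_ell2 v) - z *\<^sub>C Abs_ell2 v = 0"
  proof (rule H_op_minus_eqI)
    show "complex_of_real a / 2 * coord (Abs_ell2 v) 1 - z * coord (Abs_ell2 v) 0 = coord 0 0"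
      using aw' assms(1) by (simp add: v v_def field_simps power2_eq_square)
    show "(complex_of_real a * coord (Abs_ell2 v) 0 + coord (Abs_ell2 v) 2) / 2 - z * coord (Abs_ell2 v) 1 = coord 0 1"
      using w(1) assms(1) by (simp add: v v_def field_simps)
    show "(coord (Abs_ell2 v) (Suc k) + coord (Abs_ell2 v) (Suc (Suc (Suc k)))) / 2
        - z * coord (Abs_ell2 v) (Suc (Suc k)) = coord 0 (Suc (Suc k))" for k
      using rec [of "Suc k"] by (simp add: v v_def field_simps)
  qed
  moreover have "H_op a 0 - z *\<^sub>C 0 = 0"
    by (rule H_op_minus_eqI) simp_all
  moreover have "inj (\<lambda>x. H_op a x - z *\<^sub>C x)"
    using assms(3) by (simp add: resolvent_set_def bij_is_inj)
  ultimately have "Abs_ell2 v = 0"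
    by (metis (mono_tags, lifting) injD)
  then have "v 0 = 0"
    using v by (metis coord_simps(1))
  with assms(1) show False by (simp add: v_def)
qed

section \<open>The free kernel, case \<open>a = 1\<close>\<close>

text \<open>The term with exponent \<open>n + m + 2\<close> solves the homogeneous recurrence; the
  one with exponent \<open>|n - m|\<close> has a kink on the diagonal, which produces the source
  2.\<close>

lemma r_kern_rec:
  assumes "z \<notin> slit"
  shows "r_kern n m z + r_kern n (Suc (Suc m)) z
    = 2 * z * r_kern n (Suc m) z + (if Suc m = n then 2 else 0)"
proof -
  define w s where "w = omega z" and "s = sqrt_branch z"
  have s: "s \<noteq> 0" using sqrt_branch_nonzero [OF assms] by (simp add: s_def)
  have rec: "w ^ k + w ^ Suc (Suc k) = 2 * z * w ^ Suc k" for k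
    unfolding w_def by (rule omega_power_rec)
  define d where "d m = w ^ nat \<bar>int n - int m\<bar>" for m
  have r: "r_kern n m z = (w ^ (n + m + 2) - d m) / s" for m
    by (simp add: r_kern_def w_def s_def d_def)
  have d: "d m + d (Suc (Suc m)) = 2 * z * d (Suc m) - (if Suc m = n then 2 * s else 0)"
  proof -
    consider "Suc m = n" | k where "m = n + k" | k where "n = Suc (Suc (m + k))"
      by (metis add_Suc_right less_imp_add_positive linorder_neqE_nat not_less_eq
          less_iff_Suc_add add.commute le_iff_add less_Suc_eq_le)
    then show ?thesis
    proof cases
      \<comment> \<open>On the diagonal both neighbours equal \<open>w\<close>, and
        \<open>2 * w = 2 * z - 2 * s\<close>.\<close>
      case 1
      then have "d m = w" "d (Suc (Suc m)) = w" "d (Suc m) = 1"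
        by (auto simp: d_def)
      then show ?thesis
        using 1 by (simp add: w_def s_def omega_def)
    next
      case 2
      then have "nat \<bar>int n - int m\<bar> = k" "nat \<bar>int n - int (Suc m)\<bar> = Suc k"
        "nat \<bar>int n - int (Suc (Suc m))\<bar> = Suc (Suc k)"
        by simp_all
      then show ?thesis
        using 2 rec [of k] by (simp only: d_def) simp
    next
      case 3
      then have "nat \<bar>int n - int m\<bar> = Suc (Suc k)" "nat \<bar>int n - int (Suc m)\<bar> = Suc k"
        "nat \<bar>int n - int (Suc (Suc m))\<bar> = k"
        by simp_all
      then show ?thesis
        using 3 rec [of k] by (simp only: d_def) (simp add: add.commute)
    qed
  qed
  have "r_kern n m z + r_kern n (Suc (Suc m)) z
      = ((w ^ (n + m + 2) + w ^ Suc (Suc (n + m + 2))) - (d m + d (Suc (Suc m)))) / s"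
    by (simp add: r add_divide_distrib diff_divide_distrib)
  also have "\<dots> = 2 * z * r_kern n (Suc m) z + (if Suc m = n then 2 else 0)"
    unfolding rec d using s by (simp add: r field_simps)
  finally show ?thesis .
qed

text \<open>The two exponents differ by 2, so a factor \<open>1 - w^2 = 2 * s * w\<close> cancels
  the denominator \<open>s\<close>. The boundary rows then involve no square root.\<close>

lemma r_kern_zero_right:
  assumes "z \<notin> slit"
  shows "r_kern n 0 z = - 2 * omega z ^ Suc n"
proof -
  have "omega z ^ (n + 2) - omega z ^ n = - (omega z ^ n * (1 - (omega z)\<^sup>2))"
    by (simp add: algebra_simps power_add power2_eq_square)
  also have "\<dots> = - (omega z ^ n * (2 * sqrt_branch z * omega z))"
    by (simp only: two_sqrt_branch_omega)
  finally show ?thesis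
    using sqrt_branch_nonzero [OF assms] by (simp add: r_kern_def)
qed

text \<open>Row 0 for \<open>a = 1\<close>, which \<open>r_kern_rec\<close> does not reach; there is
  no source because \<open>n\<close> is positive.\<close>

lemma r_kern_zero_one:
  assumes "z \<notin> slit" "n \<ge> 1"
  shows "r_kern n 1 z = 2 * z * r_kern n 0 z"
proof -
  obtain k where n: "n = Suc k" using assms(2) by (metis One_nat_def Suc_le_D)
  define w s where "w = omega z" and "s = sqrt_branch z"
  have s: "s \<noteq> 0" "2 * s * w = 1 - w\<^sup>2" "2 * z * w = 1 + w\<^sup>2"
    using sqrt_branch_nonzero [OF assms(1)] two_sqrt_branch_omega two_z_omega
    by (simp_all add: s_def w_def)
  \<comment> \<open>The factor \<open>1 - w^4\<close> splits into \<open>2 * z * w\<close> times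
    \<open>2 * s * w\<close>, which again cancels \<open>s\<close>.\<close>
  have "w ^ (n + 3) - w ^ k = - (w ^ k * ((1 + w\<^sup>2) * (1 - w\<^sup>2)))"
    by (simp add: n algebra_simps power2_eq_square eval_nat_numeral)
  also have "\<dots> = s * (2 * z * (- 2 * w ^ Suc n))"
    unfolding s(2,3) [symmetric] by (simp add: n)
  finally have "(w ^ (n + 3) - w ^ k) / s = 2 * z * (- 2 * w ^ Suc n)"
    using s(1) by simp
  moreover have "nat \<bar>int n - int 1\<bar> = k" by (simp add: n)
  ultimately show ?thesis
    unfolding r_kern_zero_right [OF assms(1)] by (simp add: r_kern_def w_def s_def numeral_3_eq_3)
qed

section \<open>Verification of the resolvent entries row by row\<close>

theorem proposition5p1:
  fixes a :: real and z :: complex and n :: nat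
  assumes "a > 0"
    and "z \<notin> slit"
    and "z \<in> resolvent_set (H_op a)"
    and "n \<ge> 1"
  shows "(\<forall>m\<ge>1. cinner (resolvent (H_op a) z (e_vec n)) (e_vec m)
            = r_kern n m z - 4 * ((complex_of_real a)\<^sup>2 - 1) * inverse (D_fun a z) * z * omega z ^ (n + m + 2))
       \<and> cinner (resolvent (H_op a) z (e_vec n)) (e_vec 0)
            = r_kern n 0 z - 2 * (complex_of_real a - 1) * inverse (D_fun a z) * omega z ^ (n + 2)
                * (2 * z + complex_of_real a * omega z)"
proof -
  define w where "w = omega z"
  define b where "b = complex_of_real a"
  define E where "E = inverse (D_fun a z)"
  define u where "u m = (if m = 0 then r_kern n 0 z - 2 * (b - 1) * E * w ^ (n + 2) * (2 * z + b * w)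
      else r_kern n m z - 4 * (b\<^sup>2 - 1) * E * z * w ^ (n + m + 2))" for m
  have w: "2 * z * w = 1 + w\<^sup>2" "cmod w < 1"
    using two_z_omega norm_omega_less_1 [OF assms(2)] by (simp_all add: w_def)
  have ED: "E * (1 + (1 - b\<^sup>2) * w\<^sup>2) = 1"
    using D_fun_nonzero [OF assms(1-3)] by (simp add: E_def D_fun_def w_def b_def)
  have rec: "w ^ k + w ^ Suc (Suc k) = 2 * z * w ^ Suc k" for k
    unfolding w_def by (rule omega_power_rec)
  have r0: "r_kern n 0 z = - 2 * w ^ Suc n"
    using r_kern_zero_right [OF assms(2)] by (simp add: w_def)
  have r1: "r_kern n 1 z = 2 * z * r_kern n 0 z"
    by (rule r_kern_zero_one [OF assms(2,4)])
  have u: "coord (Abs_ell2 u) = u"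
  \<comment> \<open>From index \<open>n\<close> on, \<open>|n - m| = m - n\<close>, so every term is
    a multiple of \<open>w ^ k\<close>; \<open>n\<close> being positive keeps these indices in the
    second branch of \<open>u\<close>.\<close>
  proof (rule coord_Abs_geometric_tail [OF w(2), where N = n])
    fix k
    have "r_kern n (k + n) z = (w ^ (2 * n + 2) - 1) / sqrt_branch z * w ^ k"
      by (simp add: r_kern_def w_def power_add algebra_simps diff_divide_distrib mult_2_right)
    then show "u (k + n) = ((w ^ (2 * n + 2) - 1) / sqrt_branch z
        - 4 * (b\<^sup>2 - 1) * E * z * w ^ (2 * n + 2)) * w ^ k"
      using assms(4) by (simp add: u_def power_add algebra_simps mult_2_right)
  qed
  have "H_op a (Abs_ell2 u) - z *\<^sub>C Abs_ell2 u = e_vec n"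
  proof (rule H_op_minus_eqI)
    \<comment> \<open>Row 0, doubled. By \<open>r1\<close> the kernel terms reduce to
      \<open>2 * (b - 1) * z\<close> times \<open>r_kern n 0 z\<close>, and the last factor becomes
      \<open>E * D_fun a z - 1\<close>.\<close>
    have "b * u 1 - 2 * z * u 0 = 4 * (b - 1) * z * w ^ Suc n *
        (E * (w * (2 * z) + b * w\<^sup>2 - b * (b + 1) * w\<^sup>2) - 1)"
      unfolding u_def r1 by (simp add: r0 algebra_simps power2_eq_square)
    also have "w * (2 * z) + b * w\<^sup>2 - b * (b + 1) * w\<^sup>2 = 1 + (1 - b\<^sup>2) * w\<^sup>2"
      using w(1) by (simp add: algebra_simps power2_eq_square)
    finally have "b * u 1 - 2 * z * u 0 = 0"
      by (simp add: ED)
    then show "complex_of_real a / 2 * coord (Abs_ell2 u) 1 - z * coord (Abs_ell2 u) 0 = coord (e_vec n) 0"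
      using assms(4) by (simp add: u b_def)
  next
    \<comment> \<open>Row 1, doubled. The free recurrence would weight entry 0 by 1 instead of
      \<open>b\<close>, so \<open>r_kern n 0 z\<close> is left over; adding \<open>b * u 0\<close>
      yields the factor \<open>1 - E * D_fun a z\<close>.\<close>
    have "u 2 - 2 * z * u 1 = (if n = 1 then 2 else 0) - r_kern n 0 z
        - 4 * (b\<^sup>2 - 1) * E * z * (w ^ (n + 4) - 2 * z * w ^ (n + 3))"
      using r_kern_rec [OF assms(2), of n 0]
      by (simp add: u_def algebra_simps eval_nat_numeral)
    also have "w ^ (n + 4) - 2 * z * w ^ (n + 3) = - (w ^ (n + 2))"
      using rec [of "n + 2"] by (simp add: algebra_simps eval_nat_numeral)
    finally have "b * u 0 + u 2 - 2 * z * u 1 = (if n = 1 then 2 else 0)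
        - 2 * (b - 1) * w ^ Suc n * (1 + E * (b * (2 * z * w) + b\<^sup>2 * w\<^sup>2 - (b + 1) * (2 * z * w)))"
      by (simp add: u_def r0 algebra_simps power2_eq_square)
    also have "b * (2 * z * w) + b\<^sup>2 * w\<^sup>2 - (b + 1) * (2 * z * w) = - (1 + (1 - b\<^sup>2) * w\<^sup>2)"
      unfolding w(1) by (simp add: algebra_simps)
    also have "1 + E * - (1 + (1 - b\<^sup>2) * w\<^sup>2) = 0"
      using ED by (simp only: mult_minus_right) simp
    finally show "(complex_of_real a * coord (Abs_ell2 u) 0 + coord (Abs_ell2 u) 2) / 2 - z * coord (Abs_ell2 u) 1
        = coord (e_vec n) 1"
      by (auto simp: u b_def field_simps split: if_splits)
  next
    fix k
    \<comment> \<open>Interior rows, doubled: the correction is a constant times powers of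
      \<open>w\<close> and drops out by \<open>rec\<close>, leaving only the source of the
      kernel.\<close>
    have "u (Suc k) + u (Suc (Suc (Suc k))) - 2 * z * u (Suc (Suc k)) =
        (if Suc (Suc k) = n then 2 else 0) - 4 * (b\<^sup>2 - 1) * E * z *
        (w ^ (n + k + 3) + w ^ Suc (Suc (n + k + 3)) - 2 * z * w ^ Suc (n + k + 3))"
      using r_kern_rec [OF assms(2), of n "Suc k"]
      by (simp add: u_def algebra_simps eval_nat_numeral)
    also have "\<dots> = (if Suc (Suc k) = n then 2 else 0)"
      by (simp only: rec) simp
    finally show "(coord (Abs_ell2 u) (Suc k) + coord (Abs_ell2 u) (Suc (Suc (Suc k)))) / 2
        - z * coord (Abs_ell2 u) (Suc (Suc k)) = coord (e_vec n) (Suc (Suc k))"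
      by (auto simp: u field_simps split: if_splits)
  qed
  moreover have "inj (\<lambda>x. H_op a x - z *\<^sub>C x)"
    using assms(3) by (simp add: resolvent_set_def bij_is_inj)
  ultimately have "resolvent (H_op a) z (e_vec n) = Abs_ell2 u"
    unfolding resolvent_def by (metis (mono_tags, lifting) inv_f_f)
  then have "cinner (resolvent (H_op a) z (e_vec n)) (e_vec m) = u m" for m
    by (simp add: cinner_e u)
  then show ?thesis
    by (simp add: u_def E_def w_def b_def)
qed

end
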